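(* Let $\mathbf{X}\in\mathbb{R}^{d\times n}$ and $\mathbf{Y}\in\mathbb{R}^{d\times m}$ have columns $\mathbf{x}^{(1)},\dots,\mathbf{x}^{(n)}$ and $\mathbf{y}^{(1)},\dots,\mathbf{y}^{(m)}$, let $\mathbf{p}\in\mathbb{R}^n_{+}$, $\mathbf{q}\in\mathbb{R}^m_{+}$ be probability vectors (nonnegative entries summing to $1$), and let $\mu=\sum_{i=1}^n p_i\delta_{\mathbf{x}^{(i)}}$, $\nu=\sum_{j=1}^m q_j\delta_{\mathbf{y}^{(j)}}$ be the corresponding discrete measures. Consider the Gromov-Wasserstein problem for $\mu$ and $\nu$, $$\min_{\Gamma\in\Pi(\mathbf{p},\mathbf{q})}\ \sum_{i,j,k,l} L(\mathbf{C}^x_{ik},\mathbf{C}^y_{jl})\,\Gamma_{ij}\Gamma_{kl},$$ where $(\mathbf{C}^x,\mathbf{p})$ and $(\mathbf{C}^y,\mathbf{q})$ are (intra-space) measured similarity matrices and $L$ is a loss function. For the choice of cosine similarity (i.e. $\mathbf{C}^x_{ik}$ is the cosine similarity of $\mathbf{x}^{(i)}$ and $\mathbf{x}^{(k)}$, and $\mathbf{C}^y_{jl}$ is the cosine similarity of $\mathbf{y}^{(j)}$ and $\mathbf{y}^{(l)}$) and squared loss $L(a,b)=\tfrac12|a-b|^2$, this problem is equivalent to the problem $$\max_{\Gamma\in\Pi(\mathbf{p},\mathbf{q})}\ \|\mathbf{X}\Gamma\mathbf{Y}^\top\|_F,$$ i.e. the set of minimizers of the first problem equals the set of maximizers of the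 second.
   Context: $\Pi(\mathbf{p},\mathbf{q})=\{\Gamma\in\mathbb{R}^{n\times m}_{+} : \Gamma\mathbf{1}=\mathbf{p},\ \Gamma^\top\mathbf{1}=\mathbf{q}\}$ is the transportation polytope (matrices with nonnegative entries and prescribed row and column sums). $\|\cdot\|_F$ is the Frobenius norm. The cosine similarity of two vectors $\mathbf{a},\mathbf{b}$ is $\langle\mathbf{a},\mathbf{b}\rangle/(\|\mathbf{a}\|_2\|\mathbf{b}\|_2)$. In the sum, $i,k$ range over $\{1,\dots,n\}$ and $j,l$ over $\{1,\dots,m\}$; $\mathbf{C}^x$ is $n\times n$ and $\mathbf{C}^y$ is $m\times m$.
   Formalization: The columns of X are assumed nonzero with one common norm, and likewise those of Y; without equal norms the claim fails, e.g. d=1, X=Y=[1 2], p=q=(1/2,1/2), where every coupling minimizes the first problem but not every one maximizes the second. *)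

theory Defs
  imports "HOL-Analysis.Analysis"
begin

text \<open>
  A matrix with \<open>r\<close> rows and \<open>c\<close> columns has type \<^typ>\<open>real ^ 'c ^ 'r\<close>, so a \<open>d \<times> n\<close> matrix whose
  columns are \<open>n\<close> points of \<open>d\<close>-space has type \<^typ>\<open>real ^ 'n ^ 'd\<close>.
\<close>

definition prob_vector :: "real ^ 'n \<Rightarrow> bool" where
  "prob_vector p \<longleftrightarrow> (\<forall>i. 0 \<le> p $ i) \<and> (\<Sum>i\<in>UNIV. p $ i) = 1"

text \<open>The vector \<open>1\<close> is the all-ones vector.\<close>

definition transport_polytope :: "real ^ 'n \<Rightarrow> real ^ 'm \<Rightarrow> (real ^ 'm ^ 'n) set" where
  "transport_polytope p q =
     {\<Gamma>. (\<forall>i j. 0 \<le> \<Gamma> $ i $ j) \<and> \<Gamma> *v 1 = p \<and> transpose \<Gamma> *v 1 = q}"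

definition cosine_similarity :: "'a::real_inner \<Rightarrow> 'a \<Rightarrow> real" where
  "cosine_similarity a b = (a \<bullet> b) / (norm a * norm b)"

definition cosine_matrix :: "real ^ 'n ^ 'd \<Rightarrow> real ^ 'n ^ 'n" where
  "cosine_matrix X = (\<chi> i k. cosine_similarity (column i X) (column k X))"

definition squared_loss :: "real \<Rightarrow> real \<Rightarrow> real" where
  "squared_loss a b = 1 / 2 * \<bar>a - b\<bar>\<^sup>2"

definition gw_objective ::
    "(real \<Rightarrow> real \<Rightarrow> real) \<Rightarrow> real ^ 'n ^ 'n \<Rightarrow> real ^ 'm ^ 'm \<Rightarrow> real ^ 'm ^ 'n \<Rightarrow> real" where
  "gw_objective L Cx Cy \<Gamma> =
     (\<Sum>i\<in>UNIV. \<Sum>j\<in>UNIV. \<Sum>k\<in>UNIV. \<Sum>l\<in>UNIV.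
        L (Cx $ i $ k) (Cy $ j $ l) * \<Gamma> $ i $ j * \<Gamma> $ k $ l)"

text \<open>
  The library norm of a matrix, seen as a vector of rows, is the Euclidean norm of the vector of
  the Euclidean norms of its rows, that is, the Frobenius norm (and not the operator norm).
\<close>

abbreviation frobenius_norm :: "real ^ 'c ^ 'r \<Rightarrow> real" where
  "frobenius_norm A \<equiv> norm A"

lemma frobenius_norm_eq:
  fixes A :: "real ^ 'c ^ 'r"
  shows "frobenius_norm A = sqrt (\<Sum>i\<in>UNIV. \<Sum>j\<in>UNIV. (A $ i $ j)\<^sup>2)"
  by (simp add: norm_vec_def L2_set_def sum_nonneg)

end

theory Submission
  imports Defs
begin

text \<open>
  On the transportation polytope the terms \<open>(Cx $ i $ k)\<^sup>2\<close> and \<open>(Cy $ j $ l)\<^sup>2\<close> of the expanded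
  squared loss contribute constants depending only on the marginals. When all columns of \<open>X\<close> have
  norm \<open>r\<close> and those of \<open>Y\<close> norm \<open>s\<close>, the cross term is \<open>- (norm (X ** \<Gamma> ** transpose Y) / (r * s))\<^sup>2\<close>,
  because \<open>X ** \<Gamma> ** transpose Y\<close> is the \<open>\<Gamma>\<close>-weighted sum of the outer products of the columns. The
  objective is thus a constant minus a positive multiple of the squared Frobenius norm.
\<close>

lemma transport_polytopeD:
  assumes "\<Gamma> \<in> transport_polytope p q"
  shows "(\<Sum>j\<in>UNIV. \<Gamma> $ i $ j) = p $ i" and "(\<Sum>i\<in>UNIV. \<Gamma> $ i $ j) = q $ j"
  using assms by (auto simp: transport_polytope_def matrix_vector_mult_def transpose_def)

text \<open>This is what makes the squared Frobenius norm split into products of Gram entries of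
  \<open>X\<close> and of \<open>Y\<close>.\<close>

lemma inner_outer_product:
  fixes x x' :: "real ^ 'a" and y y' :: "real ^ 'b"
  shows "(\<chi> a b. x $ a * y $ b) \<bullet> (\<chi> a b. x' $ a * y' $ b) = (x \<bullet> x') * (y \<bullet> y')"
  by (simp add: inner_vec_def sum_product algebra_simps)

lemma matrix_mult_transpose_eq_sum_outer_products:
  fixes X :: "real ^ 'n ^ 'a" and \<Gamma> :: "real ^ 'm ^ 'n" and Y :: "real ^ 'm ^ 'b"
  shows "X ** \<Gamma> ** transpose Y =
    (\<Sum>i\<in>UNIV. \<Sum>j\<in>UNIV. \<Gamma> $ i $ j *\<^sub>R (\<chi> a b. column i X $ a * column j Y $ b))"
proof -
  have "(\<Sum>j\<in>UNIV. \<Sum>i\<in>UNIV. X $ a $ i * \<Gamma> $ i $ j * Y $ b $ j)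
      = (\<Sum>i\<in>UNIV. \<Sum>j\<in>UNIV. \<Gamma> $ i $ j * (X $ a $ i * Y $ b $ j))" for a b
    by (subst sum.swap) (simp add: algebra_simps)
  then show ?thesis
    by (simp add: vec_eq_iff matrix_matrix_mult_def transpose_def column_def sum_distrib_right)
qed

text \<open>Bilinear expansion of the inner product of the sum of outer products with itself. The
  result has the shape of the cross term, with Gram matrices in place of \<open>Cx\<close> and
  \<open>Cy\<close>.\<close>

lemma frobenius_norm_square_eq:
  fixes X :: "real ^ 'n ^ 'a" and \<Gamma> :: "real ^ 'm ^ 'n" and Y :: "real ^ 'm ^ 'b"
  shows "(frobenius_norm (X ** \<Gamma> ** transpose Y))\<^sup>2 =
    (\<Sum>i\<in>UNIV. \<Sum>j\<in>UNIV. \<Sum>k\<in>UNIV. \<Sum>l\<in>UNIV.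
       (column i X \<bullet> column k X) * (column j Y \<bullet> column l Y) * \<Gamma> $ i $ j * \<Gamma> $ k $ l)"
  unfolding power2_norm_eq_inner matrix_mult_transpose_eq_sum_outer_products inner_sum_left
  by (simp add: inner_sum_right inner_outer_product sum_distrib_left mult_ac)

text \<open>The factor \<open>f i k\<close> is free of \<open>j\<close> and \<open>l\<close>, so
  these two sums act on the entries of \<open>\<Gamma>\<close> alone and give row sums.\<close>

lemma sum_row_marginal:
  fixes f :: "'n::finite \<Rightarrow> 'n \<Rightarrow> real"
  assumes "\<Gamma> \<in> transport_polytope p q"
  shows "(\<Sum>i\<in>UNIV. \<Sum>j\<in>UNIV. \<Sum>k\<in>UNIV. \<Sum>l\<in>UNIV. f i k * \<Gamma> $ i $ j * \<Gamma> $ k $ l)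
    = (\<Sum>i\<in>UNIV. \<Sum>k\<in>UNIV. f i k * p $ i * p $ k)"
proof -
  have "(\<Sum>j\<in>UNIV. \<Sum>k\<in>UNIV. \<Sum>l\<in>UNIV. f i k * \<Gamma> $ i $ j * \<Gamma> $ k $ l)
      = (\<Sum>k\<in>UNIV. f i k * p $ i * p $ k)" for i
    by (subst sum.swap)
      (simp flip: sum_distrib_left sum_distrib_right add: transport_polytopeD[OF assms])
  then show ?thesis by simp
qed

lemma sum_column_marginal:
  fixes f :: "'m::finite \<Rightarrow> 'm \<Rightarrow> real"
  assumes "\<Gamma> \<in> transport_polytope p q"
  shows "(\<Sum>i\<in>UNIV. \<Sum>j\<in>UNIV. \<Sum>k\<in>UNIV. \<Sum>l\<in>UNIV. f j l * \<Gamma> $ i $ j * \<Gamma> $ k $ l)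
    = (\<Sum>j\<in>UNIV. \<Sum>l\<in>UNIV. f j l * q $ j * q $ l)"
proof -
  have "(\<Sum>k\<in>UNIV. \<Sum>l\<in>UNIV. f j l * \<Gamma> $ i $ j * \<Gamma> $ k $ l)
      = (\<Sum>l\<in>UNIV. f j l * q $ l) * \<Gamma> $ i $ j" for i j
  proof -
    have "(\<Sum>k\<in>UNIV. \<Sum>l\<in>UNIV. f j l * \<Gamma> $ i $ j * \<Gamma> $ k $ l)
        = (\<Sum>l\<in>UNIV. f j l * \<Gamma> $ i $ j * q $ l)"
      by (subst sum.swap) (simp flip: sum_distrib_left add: transport_polytopeD[OF assms])
    then show ?thesis by (simp add: sum_distrib_left mult_ac)
  qed
  \<comment> \<open>The bracket depends on \<open>j\<close> only; moving the sum over
    \<open>i\<close> inside exposes the column sum \<open>q $ j\<close>.\<close>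
  then have "(\<Sum>i\<in>UNIV. \<Sum>j\<in>UNIV. \<Sum>k\<in>UNIV. \<Sum>l\<in>UNIV. f j l * \<Gamma> $ i $ j * \<Gamma> $ k $ l)
      = (\<Sum>j\<in>UNIV. \<Sum>i\<in>UNIV. (\<Sum>l\<in>UNIV. f j l * q $ l) * \<Gamma> $ i $ j)"
    by (subst sum.swap) simp
  also have "\<dots> = (\<Sum>j\<in>UNIV. (\<Sum>l\<in>UNIV. f j l * q $ l) * q $ j)"
    by (simp flip: sum_distrib_left add: transport_polytopeD[OF assms])
  finally show ?thesis by (simp add: sum_distrib_left mult_ac)
qed

lemma gw_objective_squared_loss:
  assumes "\<Gamma> \<in> transport_polytope p q"
  shows "gw_objective squared_loss Cx Cy \<Gamma> =
      (\<Sum>i\<in>UNIV. \<Sum>k\<in>UNIV. (Cx $ i $ k)\<^sup>2 / 2 * p $ i * p $ k)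
    + (\<Sum>j\<in>UNIV. \<Sum>l\<in>UNIV. (Cy $ j $ l)\<^sup>2 / 2 * q $ j * q $ l)
    - (\<Sum>i\<in>UNIV. \<Sum>j\<in>UNIV. \<Sum>k\<in>UNIV. \<Sum>l\<in>UNIV.
         Cx $ i $ k * Cy $ j $ l * \<Gamma> $ i $ j * \<Gamma> $ k $ l)"
proof -
  \<comment> \<open>The weights \<open>u\<close> and \<open>v\<close> are carried along so that the
    identity applies to each summand of the fourfold sum.\<close>
  have "squared_loss a b * u * v = a\<^sup>2 / 2 * u * v + b\<^sup>2 / 2 * u * v - a * b * u * v"
    for a b u v :: real
    by (simp add: squared_loss_def power2_eq_square field_simps)
  then show ?thesis
    unfolding gw_objective_def
      sum_row_marginal[OF assms, of "\<lambda>i k. (Cx $ i $ k)\<^sup>2 / 2", symmetric]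
      sum_column_marginal[OF assms, of "\<lambda>j l. (Cy $ j $ l)\<^sup>2 / 2", symmetric]
    by (simp only: sum.distrib sum_subtractf)
qed

lemma power2_less_iff:
  fixes a b :: "'a::linordered_semidom"
  assumes "0 \<le> a" "0 \<le> b"
  shows "a\<^sup>2 < b\<^sup>2 \<longleftrightarrow> a < b"
  using assms by (simp add: power_mono_iff flip: not_le)

text \<open>Both notions say that the point is feasible and no feasible point is strictly better, so
  they depend only on the strict order among feasible points.\<close>

lemma is_arg_min_iff_is_arg_max:
  fixes f :: "'a \<Rightarrow> 'b::order" and g :: "'a \<Rightarrow> 'c::order"
  assumes "\<And>x y. P x \<Longrightarrow> P y \<Longrightarrow> f x < f y \<longleftrightarrow> g y < g x"
  shows "is_arg_min f P x \<longleftrightarrow> is_arg_max g P x"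
  using assms unfolding is_arg_min_def is_arg_max_def by blast

text \<open>Cosine similarity sees only normalized columns. Equal norms turn this normalization into
  one global factor for each of \<open>X\<close> and \<open>Y\<close>.\<close>

theorem lemma4p3:
  fixes X :: "real ^ 'n ^ 'd" and Y :: "real ^ 'm ^ 'd"
    and p :: "real ^ 'n" and q :: "real ^ 'm"
  assumes "prob_vector p" and "prob_vector q"
    and "\<And>i. column i X \<noteq> 0" and "\<And>j. column j Y \<noteq> 0"
    and "\<And>i k. norm (column i X) = norm (column k X)"
    and "\<And>j l. norm (column j Y) = norm (column l Y)"
  shows "{\<Gamma>. is_arg_min (gw_objective squared_loss (cosine_matrix X) (cosine_matrix Y))
                (\<lambda>\<Gamma>. \<Gamma> \<in> transport_polytope p q) \<Gamma>}
       = {\<Gamma>. is_arg_max (\<lambda>\<Gamma>. frobenius_norm (X ** \<Gamma> ** transpose Y))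
                (\<lambda>\<Gamma>. \<Gamma> \<in> transport_polytope p q) \<Gamma>}"
proof -
  obtain r s where r: "norm (column i X) = r" and s: "norm (column j Y) = s" for i j
    using assms(5,6) by metis
  have pos: "r > 0" "s > 0"
    using r s assms(3,4) by (metis zero_less_norm_iff)+
  define A where "A =
      (\<Sum>i\<in>UNIV. \<Sum>k\<in>UNIV. (cosine_matrix X $ i $ k)\<^sup>2 / 2 * p $ i * p $ k)
    + (\<Sum>j\<in>UNIV. \<Sum>l\<in>UNIV. (cosine_matrix Y $ j $ l)\<^sup>2 / 2 * q $ j * q $ l)"
  \<comment> \<open>The cosines have denominators \<open>r * r\<close> and \<open>s * s\<close>,
    whose product is the same for all indices and leaves the sum.\<close>
  have cross: "(\<Sum>i\<in>UNIV. \<Sum>j\<in>UNIV. \<Sum>k\<in>UNIV. \<Sum>l\<in>UNIV.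
        cosine_matrix X $ i $ k * cosine_matrix Y $ j $ l * \<Gamma> $ i $ j * \<Gamma> $ k $ l)
      = (frobenius_norm (X ** \<Gamma> ** transpose Y))\<^sup>2 / (r * s)\<^sup>2" for \<Gamma>
    unfolding frobenius_norm_square_eq
    by (simp add: cosine_matrix_def cosine_similarity_def r s sum_divide_distrib
        power2_eq_square mult_ac)
  have objective: "gw_objective squared_loss (cosine_matrix X) (cosine_matrix Y) \<Gamma>
      = A - (frobenius_norm (X ** \<Gamma> ** transpose Y))\<^sup>2 / (r * s)\<^sup>2"
    if "\<Gamma> \<in> transport_polytope p q" for \<Gamma>
    unfolding gw_objective_squared_loss[OF that] cross A_def ..
  \<comment> \<open>The constant \<open>A\<close> cancels, the minus sign reverses the order, and
    nonnegative norms compare like their squares.\<close>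
  have "gw_objective squared_loss (cosine_matrix X) (cosine_matrix Y) \<Gamma>
        < gw_objective squared_loss (cosine_matrix X) (cosine_matrix Y) \<Gamma>'
      \<longleftrightarrow> frobenius_norm (X ** \<Gamma>' ** transpose Y) < frobenius_norm (X ** \<Gamma> ** transpose Y)"
    if "\<Gamma> \<in> transport_polytope p q" "\<Gamma>' \<in> transport_polytope p q" for \<Gamma> \<Gamma>'
    using pos by (simp add: objective that divide_less_cancel power2_less_iff)
  then show ?thesis
    by (intro Collect_cong is_arg_min_iff_is_arg_max)
qed

end
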